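(* Let $n\ge1$. The poset $L(4,n)$ is the disjoint union of the following chains $C_\mu$ (each starting at the indicated $\mu$, each step adding $1$ to one entry), which are of four types; here $k$ ranges over nonnegative integers. A) $\mu=(6k,4k,2k,0)$, $k=0,1,\dots,\lfloor n/6\rfloor$: add $1$ cyclically to entries $1,2,3,4,1,2,3,4,\dots$ until reaching $(n,n-2k,n-4k,n-6k)$. B) $\mu=(6k+\ell,4k+\ell,2k,0)$, $\ell\ge2$, $k=0,1,\dots,\lfloor (n-\ell)/6\rfloor$: add $1$ cyclically to entries $1,3,2,4,1,3,2,4,\dots$ until reaching $(n,n-2k,n-4k-\ell,n-6k-\ell)$. C) $\mu=(6k+r,4k,2k,0)$, $r\ge2$, $k=0,1,\dots,\lfloor (n-r)/6\rfloor$: add $1$ cyclically to entries $2,3,4$ until reaching $(6k+r,4k+r-2,2k+r-2,r-2)$; then add $1$ to entries $2,3,2,3$ in this order, reaching $(6k+r,4k+r,2k+r,r-2)$; then add $1$ cyclically to entries $1,2,3$ until reaching $(n,n-2k,n-4k,r-2)$. D) $\mu=(6k+r+\ell,4k+\ell,2k,0)$, $\ell\ge2$, $r\ge2$, $k=0,1,\dots,\lfloor (n-r-\ell)/6\rfloor$: add $1$ alternately to entries $3,4$ (starting with $3$) until reaching $(6k+r+\ell,4k+\ell,2k+\ell-2,\ell-2)$; then add $1$ twice to entry $3$, reaching $(6k+r+\ell,4k+\ell,2k+\ell,\ell-2)$; then add $1$ alternately to entries $2,3$ (starting with $2$) until reaching $(6k+r+\ell,4k+\ell+r-2,2k+\ell+r-2,\ell-2)$;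 then add $1$ twice to entry $2$, reaching $(6k+r+\ell,4k+\ell+r,2k+\ell+r-2,\ell-2)$; then add $1$ alternately to entries $1,2$ (starting with $1$) until reaching $(n,n-2k,2k+\ell+r-2,\ell-2)$. (In types B, C, D the parameters satisfy $\ell\le n$, $r\le n$, $r+\ell\le n$ respectively.)
   Context: $L(4,n)$ is the poset of integer quadruples $\lambda=(\lambda_1,\lambda_2,\lambda_3,\lambda_4)$ with $n\ge\lambda_1\ge\lambda_2\ge\lambda_3\ge\lambda_4\ge 0$, ordered componentwise. A phase of a chain whose starting and target partitions coincide consists of zero steps. *)

theory Defs
  imports Main "HOL-Library.Product_Order" "HOL-Library.Disjoint_Sets"
begin

text \<open>The order on quadruples is the componentwise one of \<^theory>\<open>HOL-Library.Product_Order\<close>.\<close>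

type_synonym quad = "int \<times> int \<times> int \<times> int"

definition L4 :: "int \<Rightarrow> quad set" where
  "L4 n = {(a, b, c, d). n \<ge> a \<and> a \<ge> b \<and> b \<ge> c \<and> c \<ge> d \<and> d \<ge> 0}"

text \<open>Entries are numbered 1, 2, 3, 4.\<close>

fun add_one :: "nat \<Rightarrow> quad \<Rightarrow> quad" where
  "add_one i (a, b, c, d) =
     (if i = 1 then a + 1 else a, if i = 2 then b + 1 else b,
      if i = 3 then c + 1 else c, if i = 4 then d + 1 else d)"

fun walk :: "nat list \<Rightarrow> quad \<Rightarrow> nat \<Rightarrow> quad" where
  "walk es s 0 = s"
| "walk es s (Suc m) = add_one (es ! (m mod length es)) (walk es s m)"

text \<open>
  \<open>Cyclic es t\<close>: add 1 cyclically to the entries \<open>es\<close> until \<open>t\<close> is reached (no step at all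
  if the phase starts at \<open>t\<close>).
  \<open>Once es t\<close>: add 1 to the entries \<open>es\<close>, one after the other, each listed occurrence once;
  here \<open>t\<close> is the partition that this is claimed to reach.
\<close>

datatype phase = Cyclic "nat list" (target: quad) | Once "nat list" (target: quad)

text \<open>
  For a cyclic phase that never reaches its target, \<open>num_steps\<close> is unspecified;
  \<open>reaches_targets\<close> below rules this case out.
\<close>

fun num_steps :: "quad \<Rightarrow> phase \<Rightarrow> nat" where
  "num_steps s (Cyclic es t) = (LEAST m. walk es s m = t)"
| "num_steps s (Once es t) = length es"

fun phase_entries :: "phase \<Rightarrow> nat list" where
  "phase_entries (Cyclic es t) = es"
| "phase_entries (Once es t) = es"

definition phase_end :: "quad \<Rightarrow> phase \<Rightarrow> quad" where
  "phase_end s p = walk (phase_entries p) s (num_steps s p)"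

text \<open>The list of all quadruples visited, the starting one included.\<close>

fun trace :: "quad \<Rightarrow> phase list \<Rightarrow> quad list" where
  "trace s [] = [s]"
| "trace s (p # ps) =
     map (walk (phase_entries p) s) [0..<num_steps s p] @ trace (phase_end s p) ps"

fun reaches_targets :: "quad \<Rightarrow> phase list \<Rightarrow> bool" where
  "reaches_targets s [] \<longleftrightarrow> True"
| "reaches_targets s (p # ps) \<longleftrightarrow>
     phase_end s p = target p \<and> reaches_targets (phase_end s p) ps"

text \<open>The arguments are \<open>k\<close>; \<open>k\<close>, \<open>\<ell>\<close>; \<open>k\<close>, \<open>r\<close>; and \<open>k\<close>, \<open>r\<close>, \<open>\<ell>\<close>, respectively.\<close>

datatype chain_index = TypeA int | TypeB int int | TypeC int int | TypeD int int int

definition chain_indices :: "int \<Rightarrow> chain_index set" where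
  "chain_indices n =
     {TypeA k | k. 0 \<le> k \<and> k \<le> n div 6} \<union>
     {TypeB k l | k l. 2 \<le> l \<and> l \<le> n \<and> 0 \<le> k \<and> k \<le> (n - l) div 6} \<union>
     {TypeC k r | k r. 2 \<le> r \<and> r \<le> n \<and> 0 \<le> k \<and> k \<le> (n - r) div 6} \<union>
     {TypeD k r l | k r l. 2 \<le> l \<and> 2 \<le> r \<and> r + l \<le> n \<and> 0 \<le> k \<and> k \<le> (n - r - l) div 6}"

fun chain_start :: "chain_index \<Rightarrow> quad" where
  "chain_start (TypeA k) = (6*k, 4*k, 2*k, 0)"
| "chain_start (TypeB k l) = (6*k + l, 4*k + l, 2*k, 0)"
| "chain_start (TypeC k r) = (6*k + r, 4*k, 2*k, 0)"
| "chain_start (TypeD k r l) = (6*k + r + l, 4*k + l, 2*k, 0)"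

fun chain_phases :: "int \<Rightarrow> chain_index \<Rightarrow> phase list" where
  "chain_phases n (TypeA k) =
     [Cyclic [1, 2, 3, 4] (n, n - 2*k, n - 4*k, n - 6*k)]"
| "chain_phases n (TypeB k l) =
     [Cyclic [1, 3, 2, 4] (n, n - 2*k, n - 4*k - l, n - 6*k - l)]"
| "chain_phases n (TypeC k r) =
     [Cyclic [2, 3, 4] (6*k + r, 4*k + r - 2, 2*k + r - 2, r - 2),
      Once [2, 3, 2, 3] (6*k + r, 4*k + r, 2*k + r, r - 2),
      Cyclic [1, 2, 3] (n, n - 2*k, n - 4*k, r - 2)]"
| "chain_phases n (TypeD k r l) =
     [Cyclic [3, 4] (6*k + r + l, 4*k + l, 2*k + l - 2, l - 2),
      Once [3, 3] (6*k + r + l, 4*k + l, 2*k + l, l - 2),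
      Cyclic [2, 3] (6*k + r + l, 4*k + l + r - 2, 2*k + l + r - 2, l - 2),
      Once [2, 2] (6*k + r + l, 4*k + l + r, 2*k + l + r - 2, l - 2),
      Cyclic [1, 2] (n, n - 2*k, 2*k + l + r - 2, l - 2)]"

definition chain_list :: "int \<Rightarrow> chain_index \<Rightarrow> quad list" where
  "chain_list n i = trace (chain_start i) (chain_phases n i)"

end

theory Submission
  imports Defs
begin

text \<open>
  A partition \<open>(a, b, c, d)\<close> is determined by its last entry \<open>d\<close> and its consecutive differences
  \<open>a - b\<close>, \<open>b - c\<close>, \<open>c - d\<close>. Let \<open>k\<close> be half the smallest of the three differences, rounded
  down, and subtract \<open>2 * k\<close> from each of them, which leaves \<open>u\<close>, \<open>v\<close>, \<open>w\<close>; at least one of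
  these is 0 or 1. The parameter \<open>k\<close> in the definition of the chains is exactly this number,
  and it never changes along a chain. A step at entry \<open>j\<close> adds 1 to the \<open>j\<close>-th of the numbers
  \<open>u\<close>, \<open>v\<close>, \<open>w\<close>, \<open>d\<close> and subtracts 1 from the one before it, so these follow a simple
  pattern: in a cyclic phase they repeat, except that one of \<open>u\<close>, \<open>v\<close> may fall and one of
  \<open>v\<close>, \<open>w\<close>, \<open>d\<close> grows by 1 per round. For instance, in types A and B the triples
  \<open>(u, v, w)\<close> run through

    \<open>(0,0,0)\<close>, \<open>(1,0,0)\<close>, \<open>(0,1,0)\<close>, \<open>(0,0,1)\<close> and
    \<open>(0,l,0)\<close>, \<open>(1,l,0)\<close>, \<open>(1,l-1,1)\<close>, \<open>(0,l,1)\<close>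

  over and over, with \<open>d\<close> counting the rounds. The table for all types is \<open>on_chain\<close>, and
  \<open>mem_chain_list\<close> shows that it describes the chains. Given nonnegative \<open>u\<close>, \<open>v\<close>, \<open>w\<close>, \<open>d\<close>
  with one of the first three at most 1, exactly one type and one choice of its remaining parameters
  fits the table; so the table can be inverted (\<open>classify\<close>), which yields a map \<open>chain_of\<close> from
  partitions to chain indices.

  Consequently the chain with index \<open>i\<close> visits precisely those members of \<open>L4 n\<close> that \<open>chain_of\<close>
  maps to \<open>i\<close> (\<open>set_chain_list\<close>). The bound \<open>n\<close> enters only through truncation: every chain
  stops when its next step would raise the first entry above \<open>n\<close>. Since the fibres of a map are
  disjoint and cover its domain, the decomposition follows once it is known that \<open>chain_of\<close> takes
  its values among the indices admitted for \<open>n\<close> (\<open>chain_of_in_chain_indices\<close>). That the chains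
  are saturated and increasing follows from the fact that every step adds 1 to one entry.

  To compute the set visited in a cyclic phase, the walk is cut into rounds, each running once
  through the listed entries (\<open>set_trace_Cyclic\<close>). The number of steps is the least one after
  which the target is reached; as the sum of the entries grows by 1 per step, there is only one
  candidate.
\<close>

section \<open>Single steps\<close>

fun rank :: "quad \<Rightarrow> int" where
  "rank (a, b, c, d) = a + b + c + d"

lemma rank_add_one: "i \<in> {1..4} \<Longrightarrow> rank (add_one i s) = rank s + 1"
  by (cases s) auto

lemma less_add_one: "i \<in> {1..4} \<Longrightarrow> s < add_one i s"
  by (cases s) (auto simp: less_le_not_le)

lemma walk_entry:
  assumes "es \<noteq> []" "set es \<subseteq> {1..4}"
  shows "\<exists>j\<in>{1..4}. walk es s (Suc m) = add_one j (walk es s m)"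
proof -
  have "es ! (m mod length es) \<in> set es"
    using assms(1) by simp
  then show ?thesis
    using assms(2) by (auto intro!: bexI[of _ "es ! (m mod length es)"])
qed

lemma rank_walk:
  assumes "es \<noteq> []" "set es \<subseteq> {1..4}"
  shows "rank (walk es s m) = rank s + int m"
proof (induction m)
  case (Suc m)
  obtain j where "j \<in> {1..4}" "walk es s (Suc m) = add_one j (walk es s m)"
    using walk_entry[OF assms] by blast
  then show ?case
    using Suc rank_add_one by simp
qed simp

text \<open>
  By \<open>rank_walk\<close> a walk never returns to a partition, so any step number that leads to the target
  is the least one.
\<close>

lemma num_steps_Cyclic:
  assumes "es \<noteq> []" "set es \<subseteq> {1..4}" "walk es s m = t"
  shows "num_steps s (Cyclic es t) = m"
proof -
  have "m \<le> y" if "walk es s y = t" for y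
    using that assms(3) rank_walk[OF assms(1,2), of s m] rank_walk[OF assms(1,2), of s y] by simp
  then show ?thesis
    using assms(3) by (auto intro: Least_equality)
qed

section \<open>Rounds of a cyclic phase\<close>

text \<open>The effect of \<open>q\<close> complete rounds through \<open>es\<close>, when the entries in \<open>es\<close> are distinct.\<close>

fun advance :: "nat list \<Rightarrow> int \<Rightarrow> quad \<Rightarrow> quad" where
  "advance es q (a, b, c, d) =
     (if 1 \<in> set es then a + q else a, if 2 \<in> set es then b + q else b,
      if 3 \<in> set es then c + q else c, if 4 \<in> set es then d + q else d)"

text \<open>
  The partitions visited in one round through \<open>es\<close> that starts at \<open>s\<close>. The end of the round is left
  out, since it belongs to the next round or the next phase.
\<close>

fun round_states :: "nat list \<Rightarrow> quad \<Rightarrow> quad list" where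
  "round_states [] s = []"
| "round_states (e # es) s = s # round_states es (add_one e s)"

lemma set_round_states:
  "set (round_states es s) = (\<lambda>j. fold add_one (take j es) s) ` {..<length es}"
proof (induction es arbitrary: s)
  case (Cons e es)
  then show ?case
    by (simp add: lessThan_Suc_eq_insert_0 image_image)
qed simp

lemma fold_add_one_distinct: "distinct es \<Longrightarrow> fold add_one es s = advance es 1 s"
proof (induction es arbitrary: s)
  case Nil
  show ?case by (cases s) simp
next
  case (Cons e es)
  then show ?case by (cases s) auto
qed

lemma walk_within_round:
  "j \<le> length es \<Longrightarrow>
     walk es s (length es * q + j) = fold add_one (take j es) (walk es s (length es * q))"
proof (induction j)
  case (Suc j)
  then show ?case by (simp add: take_Suc_conv_app_nth)
qed simp

lemma walk_rounds:
  assumes "distinct es"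
  shows "walk es s (length es * q) = advance es (int q) s"
proof (induction q)
  case 0
  show ?case by (cases s) simp
next
  case (Suc q)
  have "walk es s (length es * Suc q) = fold add_one es (walk es s (length es * q))"
    using walk_within_round[of "length es" es s q] by (simp add: add.commute)
  then show ?case
    using Suc by (cases s) (simp add: fold_add_one_distinct[OF assms])
qed

fun entry :: "nat \<Rightarrow> quad \<Rightarrow> int" where
  "entry i (a, b, c, d) = (if i = 1 then a else if i = 2 then b else if i = 3 then c else d)"

lemma entry_add_one: "i \<in> {1..4} \<Longrightarrow> i \<noteq> j \<Longrightarrow> j \<in> {1..4} \<Longrightarrow> entry i (add_one j s) = entry i s"
  by (cases s) auto

lemma entry_advance: "i \<in> {1..4} \<Longrightarrow> i \<in> set es \<Longrightarrow> entry i (advance es q s) = entry i s + q"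
proof -
  assume "i \<in> {1..4}" "i \<in> set es"
  moreover from this(1) have "i = 1 \<or> i = 2 \<or> i = 3 \<or> i = 4" by auto
  ultimately show ?thesis by (cases s) auto
qed

text \<open>
  The entry that is raised last keeps its value until a round is over. It therefore tells how many
  rounds have been completed, and membership in the walk can be expressed without an existential
  quantifier over the round.
\<close>

lemma entry_last_round_states:
  assumes "distinct es" "es \<noteq> []" "set es \<subseteq> {1..4}" "x \<in> set (round_states es s)"
  shows "entry (last es) x = entry (last es) s"
  using assms
proof (induction es arbitrary: s)
  case (Cons e es)
  show ?case
  proof (cases "es = [] \<or> x = s")
    case True
    then show ?thesis using Cons.prems by auto
  next
    case False
    then have "last es \<in> set es" by simp
    then have "last es \<noteq> e" "last es \<in> {1..4}" "e \<in> {1..4}" using Cons.prems by auto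
    moreover have "entry (last es) x = entry (last es) (add_one e s)"
      using False Cons by simp
    ultimately show ?thesis
      using False entry_add_one by simp
  qed
qed simp

lemma walk_image_rounds:
  fixes es s
  assumes "distinct es" "es \<noteq> []" "set es \<subseteq> {1..4}"
  defines "q x \<equiv> entry (last es) x - entry (last es) s"
  shows "walk es s ` {0..<length es * nat Q} =
     {x. 0 \<le> q x \<and> q x < Q \<and> x \<in> set (round_states es (advance es (q x) s))}" (is "?L = ?R")
proof
  show "?L \<subseteq> ?R"
  proof
    fix x assume "x \<in> ?L"
    then obtain m where m: "m < length es * nat Q" "x = walk es s m" by auto
    define p j where "p = m div length es" and "j = m mod length es"
    have j: "j < length es" using assms by (simp add: j_def)
    have "m = length es * p + j" by (simp add: p_def j_def)
    then have "x = fold add_one (take j es) (advance es (int p) s)"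
      using m(2) j walk_within_round[of j es s p] walk_rounds[OF assms(1)] by simp
    then have x: "x \<in> set (round_states es (advance es (int p) s))"
      using j by (auto simp: set_round_states)
    have "last es \<in> set es" "last es \<in> {1..4}"
      using assms(2,3) last_in_set by blast+
    then have "q x = int p"
      using entry_last_round_states[OF assms(1-3) x] entry_advance by (simp add: q_def)
    moreover have "p < nat Q"
      using m(1) by (simp add: p_def less_mult_imp_div_less mult.commute)
    ultimately show "x \<in> ?R"
      using x by auto
  qed
  show "?R \<subseteq> ?L"
  proof
    fix x assume "x \<in> ?R"
    then obtain p j where p: "0 \<le> p" "p < Q" and j: "j < length es"
      and x: "x = fold add_one (take j es) (advance es p s)"
      by (auto simp: set_round_states)
    have "x = walk es s (length es * nat p + j)"
      using x j p(1) walk_within_round[of j es s "nat p"] walk_rounds[OF assms(1)] by simp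
    moreover have "length es * nat p + j < length es * nat Q"
    proof -
      have "length es * nat p + j < length es * Suc (nat p)" using j by simp
      also have "\<dots> \<le> length es * nat Q" using p by (intro mult_le_mono2) auto
      finally show ?thesis .
    qed
    ultimately show "x \<in> ?L" by auto
  qed
qed

lemma cyclic_phase:
  fixes es s
  defines "q x \<equiv> entry (last es) x - entry (last es) s"
  assumes "distinct es" "es \<noteq> []" "set es \<subseteq> {1..4}" "0 \<le> Q" "t = advance es Q s"
  shows phase_end_Cyclic: "phase_end s (Cyclic es t) = t"
    and set_trace_Cyclic: "set (trace s (Cyclic es t # ps)) =
      {x. 0 \<le> q x \<and> q x < Q \<and> x \<in> set (round_states es (advance es (q x) s))} \<union> set (trace t ps)"
proof -
  have w: "walk es s (length es * nat Q) = t"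
    using walk_rounds[OF assms(2)] assms(5,6) by simp
  have n: "num_steps s (Cyclic es t) = length es * nat Q"
    by (rule num_steps_Cyclic[OF assms(3,4) w])
  show e: "phase_end s (Cyclic es t) = t"
    unfolding phase_end_def n using w by simp
  show "set (trace s (Cyclic es t # ps)) =
      {x. 0 \<le> q x \<and> q x < Q \<and> x \<in> set (round_states es (advance es (q x) s))} \<union> set (trace t ps)"
    unfolding trace.simps e n q_def
    using walk_image_rounds[OF assms(2-4)] by simp
qed

lemma phase_end_Once: "phase_end s (Once es t) = fold add_one es s"
  using walk_within_round[of "length es" es s 0] by (simp add: phase_end_def)

lemma set_trace_Once:
  "set (trace s (Once es t # ps)) =
     set (round_states es s) \<union> set (trace (fold add_one es s) ps)"
proof -
  have "walk es s j = fold add_one (take j es) s" if "j < length es" for j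
    using walk_within_round[of j es s 0] that by simp
  then have "walk es s ` {0..<length es} = set (round_states es s)"
    by (auto simp: set_round_states)
  then show ?thesis
    by (simp add: phase_end_Once)
qed

section \<open>Chains are saturated and increasing\<close>

lemma hd_trace: "trace s ps \<noteq> [] \<and> hd (trace s ps) = s"
proof (induction ps arbitrary: s)
  case (Cons p ps)
  then show ?case
    by (cases "num_steps s p") (auto simp: phase_end_def hd_append hd_map upt_rec)
qed simp

lemma successively_trace:
  assumes "\<forall>p\<in>set ps. phase_entries p \<noteq> [] \<and> set (phase_entries p) \<subseteq> {1..4}"
  shows "successively (\<lambda>x y. \<exists>j\<in>{1..4}. y = add_one j x) (trace s ps)"
  using assms
proof (induction ps arbitrary: s)
  case (Cons p ps)
  let ?R = "\<lambda>x y. \<exists>j\<in>{1..4::nat}. y = add_one j x"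
  let ?w = "walk (phase_entries p) s"
  have step: "?R (?w m) (?w (Suc m))" for m
    using Cons.prems by (intro walk_entry) auto
  have 1: "successively ?R (map ?w [0..<N])" for N
    unfolding successively_conv_nth using step by (auto simp del: walk.simps)
  show ?case
  proof (cases "num_steps s p")
    case 0
    then show ?thesis using Cons by simp
  next
    case (Suc N)
    then show ?thesis
      using Cons 1[of "Suc N"] step[of N] hd_trace[of "phase_end s p" ps]
      by (simp add: successively_append_iff successively_Cons phase_end_def del: walk.simps)
  qed
qed simp

lemma sorted_if_successively_add_one:
  assumes "successively (\<lambda>x y. \<exists>j \<in> {1..4}. y = add_one j x) xs"
  shows "sorted_wrt (<) xs"
proof -
  have "successively (<) xs"
    using assms by (rule successively_mono) (use less_add_one in blast)
  then show ?thesis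
    by (simp add: successively_conv_sorted_wrt)
qed

section \<open>The partitions visited by each chain\<close>

lemma mem_chain_indices:
  "TypeA k \<in> chain_indices n \<longleftrightarrow> 0 \<le> k \<and> 6 * k \<le> n"
  "TypeB k l \<in> chain_indices n \<longleftrightarrow> 0 \<le> k \<and> 2 \<le> l \<and> 6 * k + l \<le> n"
  "TypeC k r \<in> chain_indices n \<longleftrightarrow> 0 \<le> k \<and> 2 \<le> r \<and> 6 * k + r \<le> n"
  "TypeD k r l \<in> chain_indices n \<longleftrightarrow> 0 \<le> k \<and> 2 \<le> r \<and> 2 \<le> l \<and> 6 * k + r + l \<le> n"
  by (auto simp: chain_indices_def)

text \<open>
  Here and in \<open>mem_chain_list\<close>, the value of \<open>Q\<close> is the number of rounds in a cyclic phase: the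
  difference between target and start in any of the entries that are raised.
\<close>

lemma reaches_targets_chain:
  assumes "i \<in> chain_indices n"
  shows "reaches_targets (chain_start i) (chain_phases n i)"
proof (cases i)
  case (TypeA k)
  show ?thesis
    using assms TypeA
    by (auto simp: mem_chain_indices phase_end_Cyclic[where Q = "n - 6 * k"])
next
  case (TypeB k l)
  show ?thesis
    using assms TypeB
    by (auto simp: mem_chain_indices phase_end_Cyclic[where Q = "n - 6 * k - l"])
next
  case (TypeC k r)
  show ?thesis
    using assms TypeC
    by (auto simp: mem_chain_indices phase_end_Once
      phase_end_Cyclic[where Q = "r - 2"] phase_end_Cyclic[where Q = "n - 6 * k - r"])
next
  case (TypeD k r l)
  show ?thesis
    using assms TypeD
    by (auto simp: mem_chain_indices phase_end_Once
      phase_end_Cyclic[where Q = "l - 2"] phase_end_Cyclic[where Q = "r - 2"]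
      phase_end_Cyclic[where Q = "n - 6 * k - r - l"])
qed

definition partition_of :: "int \<Rightarrow> int \<Rightarrow> int \<Rightarrow> int \<Rightarrow> int \<Rightarrow> quad" where
  "partition_of k u v w d = (d + w + v + u + 6 * k, d + w + v + 4 * k, d + w + 2 * k, d)"

lemma partition_of_differences:
  "partition_of k (a - b - 2 * k) (b - c - 2 * k) (c - d - 2 * k) d = (a, b, c, d)"
  by (simp add: partition_of_def)

fun level :: "chain_index \<Rightarrow> int" where
  "level (TypeA k) = k"
| "level (TypeB k l) = k"
| "level (TypeC k r) = k"
| "level (TypeD k r l) = k"

text \<open>
  Here \<open>u\<close>, \<open>v\<close>, \<open>w\<close> are the differences reduced by \<open>2 * k\<close>. In type C, the first two lines
  are the phase that raises \<open>d\<close>, in which \<open>u\<close> falls, up to the second of the four single steps;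
  the third single step leads to the third line, and the fourth one to the last phase, in which
  \<open>w\<close> grows. In type D, the first two lines are the phase in which \<open>v\<close> falls while \<open>d\<close> grows, the
  next two the phase in which \<open>u\<close> falls while \<open>w\<close> grows, and the last line is the phase in which
  \<open>v\<close> grows; of the two single steps after each of the first two phases, the second one changes
  the group of lines.
\<close>

fun on_chain :: "chain_index \<Rightarrow> int \<Rightarrow> int \<Rightarrow> int \<Rightarrow> int \<Rightarrow> bool" where
  "on_chain (TypeA k) u v w d \<longleftrightarrow> (u, v, w) \<in> {(0, 0, 0), (1, 0, 0), (0, 1, 0), (0, 0, 1)}"
| "on_chain (TypeB k l) u v w d \<longleftrightarrow> (u, v, w) \<in> {(0, l, 0), (1, l, 0), (1, l - 1, 1), (0, l, 1)}"
| "on_chain (TypeC k r) u v w d \<longleftrightarrow>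
     2 \<le> u \<and> (v, w) = (0, 0) \<and> d = r - u \<or>
     1 \<le> u \<and> (v, w) \<in> {(1, 0), (0, 1)} \<and> d = r - 1 - u \<or>
     (u, v, w) = (0, 1, 1) \<and> d = r - 2 \<or>
     2 \<le> w \<and> (u, v) \<in> {(0, 0), (1, 0), (0, 1)} \<and> d = r - 2"
| "on_chain (TypeD k r l) u v w d \<longleftrightarrow>
     2 \<le> v \<and> (u, w) = (r, 0) \<and> d = l - v \<or>
     1 \<le> v \<and> (u, w) = (r, 1) \<and> d = l - 1 - v \<or>
     2 \<le> u \<and> 2 \<le> w \<and> v = 0 \<and> u + w = r + 2 \<and> d = l - 2 \<or>
     1 \<le> u \<and> 2 \<le> w \<and> v = 1 \<and> u + w = r + 1 \<and> d = l - 2 \<or>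
     2 \<le> v \<and> w = r \<and> u \<in> {0, 1} \<and> d = l - 2"

text \<open>
  Rewriting with the traces of the phases turns the left-hand side into linear conditions on the
  coordinates. The last phase of each type raises the first entry first in every round, and its
  target has first entry \<open>n\<close> and is the end of a round. So the target is the last partition of the
  endless walk whose first entry is at most \<open>n\<close>, and the table, which continues all chains
  endlessly, only has to be cut off by that inequality.
\<close>

lemma mem_chain_list:
  assumes "i \<in> chain_indices n"
  shows "partition_of (level i) u v w d \<in> set (chain_list n i) \<longleftrightarrow>
    0 \<le> d \<and> d + w + v + u + 6 * level i \<le> n \<and> on_chain i u v w d"
proof (cases i)
  case (TypeA k)
  show ?thesis
    using assms[unfolded TypeA mem_chain_indices] unfolding TypeA
    by (simp add: partition_of_def chain_list_def
          set_trace_Cyclic[where Q = "n - 6 * k"]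
        del: trace.simps(2)) (smt (z3))
next
  case (TypeB k l)
  show ?thesis
    using assms[unfolded TypeB mem_chain_indices] unfolding TypeB
    by (simp add: partition_of_def chain_list_def
          set_trace_Cyclic[where Q = "n - 6 * k - l"]
        del: trace.simps(2)) (smt (z3))
next
  case (TypeC k r)
  show ?thesis
    using assms[unfolded TypeC mem_chain_indices] unfolding TypeC
    by (simp add: partition_of_def chain_list_def set_trace_Once
          set_trace_Cyclic[where Q = "r - 2"] set_trace_Cyclic[where Q = "n - 6 * k - r"]
        del: trace.simps(2)) (smt (z3))
next
  case (TypeD k r l)
  show ?thesis
    using assms[unfolded TypeD mem_chain_indices] unfolding TypeD
    by (simp add: partition_of_def chain_list_def set_trace_Once
          set_trace_Cyclic[where Q = "l - 2"] set_trace_Cyclic[where Q = "r - 2"]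
          set_trace_Cyclic[where Q = "n - 6 * k - r - l"]
        del: trace.simps(2)) (smt (z3))
qed

lemma on_chain_bounds:
  assumes "i \<in> chain_indices n" "on_chain i u v w d"
  shows "0 \<le> level i" "0 \<le> u" "0 \<le> v" "0 \<le> w" "u \<le> 1 \<or> v \<le> 1 \<or> w \<le> 1"
  using assms by (cases i; auto simp: mem_chain_indices)+

section \<open>The chain through a given partition\<close>

text \<open>
  The inverse of the table \<open>on_chain\<close>, see \<open>classify_eq_iff\<close>. The order of the tests matters: each
  branch relies on the previous ones having excluded the triples that fit several patterns.
\<close>

fun classify :: "int \<Rightarrow> int \<Rightarrow> int \<Rightarrow> int \<Rightarrow> int \<Rightarrow> chain_index" where
  "classify k u v w d =
     (if u + v + w \<le> 1 then TypeA k
      else if u \<le> 1 \<and> v \<ge> 2 \<and> w = 0 \<or> u = 0 \<and> v \<ge> 2 \<and> w = 1 then TypeB k v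
      else if u = 1 \<and> v \<ge> 1 \<and> w = 1 then TypeB k (v + 1)
      else if v + w = 0 then TypeC k (u + d)
      else if u \<ge> 1 \<and> v + w = 1 then TypeC k (u + 1 + d)
      else if u + v \<le> 1 then TypeC k (d + 2)
      else if w = 0 then TypeD k u (v + d)
      else if w = 1 then TypeD k u (v + 1 + d)
      else if v = 0 then TypeD k (u + w - 2) (d + 2)
      else if v = 1 then TypeD k (u + w - 1) (d + 2)
      else TypeD k w (d + 2))"

lemma classify_eq_iff:
  assumes "i \<in> chain_indices n" "0 \<le> u" "0 \<le> v" "0 \<le> w" "u \<le> 1 \<or> v \<le> 1 \<or> w \<le> 1"
  shows "classify k u v w d = i \<longleftrightarrow> level i = k \<and> on_chain i u v w d"
  using assms by (cases i; simp add: mem_chain_indices; smt (z3))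

fun chain_of :: "quad \<Rightarrow> chain_index" where
  "chain_of (a, b, c, d) =
     (let k = min (a - b) (min (b - c) (c - d)) div 2
      in classify k (a - b - 2 * k) (b - c - 2 * k) (c - d - 2 * k) d)"

text \<open>
  Any \<open>k\<close> that leaves nonnegative differences, one of them at most 1, is the right one. So the
  rounded half of the minimum need not be computed again for each partition on a chain.
\<close>

lemma chain_of_eq:
  assumes "0 \<le> a - b - 2 * k" "0 \<le> b - c - 2 * k" "0 \<le> c - d - 2 * k"
    and "a - b - 2 * k \<le> 1 \<or> b - c - 2 * k \<le> 1 \<or> c - d - 2 * k \<le> 1"
  shows "chain_of (a, b, c, d) = classify k (a - b - 2 * k) (b - c - 2 * k) (c - d - 2 * k) d"
proof -
  have "min (a - b) (min (b - c) (c - d)) div 2 = k"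
    using assms by (auto simp: min_def)
  then show ?thesis by (simp add: Let_def)
qed

lemma level_exists:
  fixes x y z :: int
  assumes "0 \<le> x" "0 \<le> y" "0 \<le> z"
  obtains k where "0 \<le> k" "0 \<le> x - 2 * k" "0 \<le> y - 2 * k" "0 \<le> z - 2 * k"
    "x - 2 * k \<le> 1 \<or> y - 2 * k \<le> 1 \<or> z - 2 * k \<le> 1"
proof
  let ?k = "min x (min y z) div 2"
  show "0 \<le> ?k" using assms by simp
  show "0 \<le> x - 2 * ?k" "0 \<le> y - 2 * ?k" "0 \<le> z - 2 * ?k"
    "x - 2 * ?k \<le> 1 \<or> y - 2 * ?k \<le> 1 \<or> z - 2 * ?k \<le> 1"
    by (auto simp: min_def)
qed

lemma L4_coordinates:
  assumes "x \<in> L4 n"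
  obtains k u v w d where
    "x = partition_of k u v w d"
    "0 \<le> k" "0 \<le> u" "0 \<le> v" "0 \<le> w" "0 \<le> d" "d + w + v + u + 6 * k \<le> n"
    "u \<le> 1 \<or> v \<le> 1 \<or> w \<le> 1" "chain_of x = classify k u v w d"
proof -
  obtain a b c d where x: "x = (a, b, c, d)" by (cases x)
  with assms have le: "0 \<le> a - b" "0 \<le> b - c" "0 \<le> c - d" "0 \<le> d" "a \<le> n"
    by (auto simp: L4_def)
  from le(1-3) obtain k where k: "0 \<le> k"
    "0 \<le> a - b - 2 * k" "0 \<le> b - c - 2 * k" "0 \<le> c - d - 2 * k"
    "a - b - 2 * k \<le> 1 \<or> b - c - 2 * k \<le> 1 \<or> c - d - 2 * k \<le> 1"
    by (rule level_exists)
  show ?thesis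
    by (rule that[of k "a - b - 2 * k" "b - c - 2 * k" "c - d - 2 * k" d])
       (use x k le chain_of_eq[OF k(2-5)] in \<open>auto simp: partition_of_def\<close>)
qed

text \<open>
  The bound by \<open>n\<close> on a chain index says that the first entry of the chain's start is at most \<open>n\<close>.
  No step lowers the first entry, so the first entry of any partition on the chain is at least
  that of the start.
\<close>

lemma chain_of_in_chain_indices:
  assumes "x \<in> L4 n"
  shows "chain_of x \<in> chain_indices n"
proof -
  obtain k u v w d where c:
    "x = partition_of k u v w d"
    "0 \<le> k" "0 \<le> u" "0 \<le> v" "0 \<le> w" "0 \<le> d" "d + w + v + u + 6 * k \<le> n"
    "u \<le> 1 \<or> v \<le> 1 \<or> w \<le> 1" "chain_of x = classify k u v w d"
    using assms by (rule L4_coordinates)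
  show ?thesis
    unfolding c(9) using c(2-8) by (auto simp: mem_chain_indices)
qed

lemma set_chain_list:
  assumes i: "i \<in> chain_indices n"
  shows "set (chain_list n i) = {x \<in> L4 n. chain_of x = i}"
proof (intro set_eqI iffI)
  fix x assume x: "x \<in> set (chain_list n i)"
  obtain a b c d where abcd: "x = (a, b, c, d)" by (cases x)
  define k u v w where coords: "k = level i" "u = a - b - 2 * k" "v = b - c - 2 * k"
    "w = c - d - 2 * k"
  have x_eq: "x = partition_of (level i) u v w d"
    unfolding abcd coords by (simp only: partition_of_differences)
  with x have d: "0 \<le> d" and a: "d + w + v + u + 6 * k \<le> n" and on: "on_chain i u v w d"
    using mem_chain_list[OF i] by (auto simp: coords(1))
  note b = on_chain_bounds[OF i on]
  have "chain_of x = classify k u v w d"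
    using chain_of_eq[of a b k c d] b unfolding abcd coords by blast
  also have "\<dots> = i"
    using classify_eq_iff[OF i b(2-5)] on coords(1) by blast
  finally have "chain_of x = i" .
  moreover have "x \<in> L4 n"
    using a b d unfolding abcd coords by (simp add: L4_def)
  ultimately show "x \<in> {x \<in> L4 n. chain_of x = i}" by simp
next
  fix x assume x: "x \<in> {x \<in> L4 n. chain_of x = i}"
  then have "x \<in> L4 n" by simp
  then obtain k u v w d where c:
    "x = partition_of k u v w d"
    "0 \<le> k" "0 \<le> u" "0 \<le> v" "0 \<le> w" "0 \<le> d" "d + w + v + u + 6 * k \<le> n"
    "u \<le> 1 \<or> v \<le> 1 \<or> w \<le> 1" "chain_of x = classify k u v w d"
    by (rule L4_coordinates)
  with x have "level i = k" "on_chain i u v w d"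
    using classify_eq_iff[OF i c(3-5,8)] by auto
  then show "x \<in> set (chain_list n i)"
    using mem_chain_list[OF i] c(1,6,7) by auto
qed

section \<open>The chain decomposition\<close>

theorem theorem14:
  fixes n :: int
  assumes "n \<ge> 1"
  shows "(\<forall>i \<in> chain_indices n.
            reaches_targets (chain_start i) (chain_phases n i) \<and>
            successively (\<lambda>x y. \<exists>j \<in> {1..4}. y = add_one j x) (chain_list n i) \<and>
            sorted_wrt (<) (chain_list n i) \<and>
            set (chain_list n i) \<subseteq> L4 n) \<and>
         disjoint_family_on (\<lambda>i. set (chain_list n i)) (chain_indices n) \<and>
         (\<Union>i \<in> chain_indices n. set (chain_list n i)) = L4 n"
proof (intro conjI ballI)
  fix i assume i: "i \<in> chain_indices n"
  show "reaches_targets (chain_start i) (chain_phases n i)"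
    using i by (rule reaches_targets_chain)
  show succ: "successively (\<lambda>x y. \<exists>j \<in> {1..4}. y = add_one j x) (chain_list n i)"
    unfolding chain_list_def by (rule successively_trace) (cases i; auto)
  show "sorted_wrt (<) (chain_list n i)"
    using succ by (rule sorted_if_successively_add_one)
  show "set (chain_list n i) \<subseteq> L4 n"
    using set_chain_list[OF i] by auto
next
  show "disjoint_family_on (\<lambda>i. set (chain_list n i)) (chain_indices n)"
    by (auto simp: disjoint_family_on_def set_chain_list)
next
  show "(\<Union>i \<in> chain_indices n. set (chain_list n i)) = L4 n"
    using chain_of_in_chain_indices by (auto simp: set_chain_list)
qed

end
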